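(* Let $n\ge 1$ and let $A'$ be the set of the encodings of all 2-chains of proper subsets of $[n]=\{1,\dots,n\}$, i.e. of all pairs $(A_1,A_2)\in 2^{[n]}\times 2^{[n]}$ with $A_1\subsetneq A_2$. Then there exists a universal cycle for $A'$.
   Context: Let $s_1,s_2\in\{0,1\}^n$ be the indicator strings of $A_1,A_2\subseteq[n]$. The pair $(A_1,A_2)$ is encoded by the word $s=s_1\odot s_2$ of length $n$ over $\{0,1,2,3\}$, where $s[i]=0,1,2,3$ according as $s_1[i]s_2[i]$ is $00,01,10,11$. A universal cycle for a finite set $A'$ of words of length $n$ over a finite alphabet is a cyclic sequence $c_0c_1\cdots c_{L-1}$ of letters, with $L=|A'|$, such that every word of $A'$ occurs exactly once among the $L$ windows $c_ic_{i+1}\cdots c_{i+n-1}$, $0\le i<L$ (indices modulo $L$). *)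

theory Defs
  imports Main
begin

definition indicator_string :: "nat \<Rightarrow> nat set \<Rightarrow> nat list" where
  "indicator_string n A = map (\<lambda>i. if i \<in> A then 1 else 0) [1..<Suc n]"

text \<open>Each pair of bits is read as a two-digit binary number, so that
  00, 01, 10, 11 become the letters 0, 1, 2, 3.\<close>

definition combine :: "nat list \<Rightarrow> nat list \<Rightarrow> nat list" (infixl "\<odot>" 70) where
  "s1 \<odot> s2 = map2 (\<lambda>a b. 2 * a + b) s1 s2"

definition encoding :: "nat \<Rightarrow> nat set \<times> nat set \<Rightarrow> nat list" where
  "encoding n = (\<lambda>(A1, A2). indicator_string n A1 \<odot> indicator_string n A2)"

definition proper_two_chains :: "nat \<Rightarrow> (nat set \<times> nat set) set" where
  "proper_two_chains n = {(A1, A2) \<in> Pow {1..n} \<times> Pow {1..n}. A1 \<subset> A2}"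

definition window :: "'a list \<Rightarrow> nat \<Rightarrow> nat \<Rightarrow> 'a list" where
  "window c n i = map (\<lambda>j. c ! ((i + j) mod length c)) [0..<n]"

text \<open>The list \<open>c\<close> is a representative of the cyclic sequence. The first three conjuncts
  state the standing conventions on the alphabet \<open>\<Sigma>\<close> and the set \<open>W\<close> of words; finiteness
  of \<open>W\<close> also makes \<open>card W\<close> its actual number of elements.\<close>

definition universal_cycle :: "'a set \<Rightarrow> nat \<Rightarrow> 'a list set \<Rightarrow> 'a list \<Rightarrow> bool" where
  "universal_cycle \<Sigma> n W c \<longleftrightarrow>
     finite \<Sigma> \<and> finite W \<and> W \<subseteq> {w. set w \<subseteq> \<Sigma> \<and> length w = n} \<and>
     set c \<subseteq> \<Sigma> \<and> length c = card W \<and>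
     (\<forall>w\<in>W. \<exists>!i. i < length c \<and> window c n i = w)"

end

theory Submission
  imports Defs "HOL-Combinatorics.Orbits"
begin

text \<open>
  In a pair \<open>A\<^sub>1 \<subset> A\<^sub>2\<close> no position carries the bits \<open>10\<close>, and properness means that some position
  carries \<open>01\<close>. So the encodings are exactly the words of length \<open>n\<close> over \<open>{0, 1, 3}\<close> that contain
  the letter \<open>1\<close> (\<open>encoding_two_chains\<close>), and it remains to find a universal cycle for
  the words over an alphabet that contain a fixed letter \<open>a\<close>.

  The usual argument would take an Eulerian circuit of the de Bruijn graph whose edges are these
  words. Here Euler's theorem appears in the form of a permutation of the edges. Let
  a shift permutation of a set \<open>W\<close> of words map every word to one that may follow it in a sliding
  window. A shift permutation that is a single cycle is a universal cycle: read off the first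
  letters along the orbit (\<open>nth_shift_orbit\<close>). To get a single cycle, choose a shift permutation
  and an orbit of it that is as large as possible. If a word \<open>u\<close> in the orbit and a word \<open>v\<close> outside
  end in the same \<open>n - 1\<close> letters, they can exchange their successors, and this joins
  their two cycles (\<open>merge_orbits\<close>), contradicting maximality. Hence the orbit is closed
  under all window shifts that stay in \<open>W\<close>, and it is all of \<open>W\<close> if \<open>W\<close> is connected
  (\<open>exists_cyclic_shift_permutation\<close>).

  Words containing \<open>a\<close> satisfy both requirements. Rotation is a shift permutation of them. They are
  connected because every such word can be shifted into \<open>a\<^sup>n\<close> by appending copies of \<open>a\<close>, and
  from \<open>a\<^sup>n\<close> any word \<open>p a q\<close> is reached via its rotation \<open>a q p\<close>
  (\<open>shift_connected_words_containing\<close>).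
\<close>

section \<open>Merging cycles of a permutation\<close>

text \<open>
  Exchanging the images of two points on different cycles joins the cycles. The proof
  does not trace the new cycle: if \<open>v\<close> were missing from the new orbit of \<open>u\<close>, that orbit would
  run from \<open>f v\<close> along the old cycle of \<open>v\<close> and so meet \<open>v\<close>; and once it contains both \<open>u\<close> and \<open>v\<close>, the
  exchange is invisible to it as a set, so it is closed under \<open>f\<close>.
\<close>

lemma merge_orbits:
  assumes "permutation f" and v: "v \<notin> orbit f u"
  shows "orbit f u \<union> orbit f v \<subseteq> orbit (f \<circ> transpose u v) u"
proof -
  define g where "g = f \<circ> transpose u v"
  have gu: "g u = f v" and gv: "g v = f u"
    by (auto simp: g_def)
  have g: "g x = f x" if "x \<noteq> u" "x \<noteq> v" for x
    using that by (simp add: g_def transpose_def)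
  have "permutation g"
    unfolding g_def by (intro permutation_compose permutation_swap_id assms(1))
  then have u_in: "u \<in> orbit g u"
    by (rule permutation_self_in_orbit)
  have self: "x \<in> orbit f x" for x
    by (rule permutation_self_in_orbit) fact
  have u: "u \<notin> orbit f v"
    using v self orbit_swap by metis
  have v_in: "v \<in> orbit g u"
  proof (rule ccontr)
    assume v_notin: "v \<notin> orbit g u"
    have "y \<in> orbit g u" if "y \<in> orbit f v" for y
      using that
    proof induction
      case base
      then show ?case using orbit.base[of g u] gu by simp
    next
      case (step y)
      then have "y \<noteq> u" "y \<noteq> v" using u v_notin by auto
      then show ?case using orbit.step[OF step.IH] g by simp
    qed
    then show False using self v_notin by blast
  qed
  have closed: "f y \<in> orbit g u" if "y \<in> orbit g u" for y
  proof (cases "y = u \<or> y = v")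
    case True
    then show ?thesis
      using orbit.step[OF u_in] orbit.step[OF v_in] gu gv by auto
  next
    case False
    then show ?thesis using orbit.step[OF that] g by simp
  qed
  have "y \<in> orbit g u" if "y \<in> orbit f x" "x \<in> orbit g u" for x y
    using that by induction (auto intro: closed)
  then show ?thesis using u_in v_in unfolding g_def by blast
qed

section \<open>Universal cycles from shift permutations\<close>

text \<open>
  For nonempty words, \<open>butlast (f w) = tl w\<close> says that \<open>f w\<close> arises from \<open>w\<close> by dropping the first letter
  and appending some letter. Such permutations are the ways to pair, at each vertex of
  the de Bruijn graph, the incoming edges with the outgoing ones, that is, the decompositions
  of its edge set into closed trails.
\<close>

definition shift_permutation :: "'a list set \<Rightarrow> ('a list \<Rightarrow> 'a list) \<Rightarrow> bool" where
  "shift_permutation W f \<longleftrightarrow> f permutes W \<and> (\<forall>w\<in>W. butlast (f w) = tl w)"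

definition shift_closed :: "'a list set \<Rightarrow> 'a list set \<Rightarrow> bool" where
  "shift_closed W S \<longleftrightarrow> (\<forall>u\<in>S. \<forall>a. tl u @ [a] \<in> W \<longrightarrow> tl u @ [a] \<in> S)"

lemma shift_permutation_swap:
  assumes "shift_permutation W f" "u \<in> W" "v \<in> W" "tl u = tl v"
  shows "shift_permutation W (f \<circ> transpose u v)"
  using assms permutes_compose[OF permutes_swap_id]
  by (auto simp: shift_permutation_def transpose_def)

text \<open>
  This is the core of Euler's theorem. The premise \<open>perm\<close> stands for the graph being balanced, and
  \<open>connected\<close> for its being connected: no proper nonempty part of \<open>W\<close> is closed under following
  edges.
\<close>

lemma exists_cyclic_shift_permutation:
  assumes "finite W" "W \<noteq> {}"
    and perm: "shift_permutation W f\<^sub>0"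
    and connected: "\<And>S. S \<subseteq> W \<Longrightarrow> S \<noteq> {} \<Longrightarrow> shift_closed W S \<Longrightarrow> S = W"
  obtains f x where "shift_permutation W f" "x \<in> W" "orbit f x = W"
proof -
  let ?P = "\<lambda>(f, x). shift_permutation W f \<and> x \<in> W"
  let ?m = "\<lambda>(f, x). card (orbit f x)"
  have sub: "orbit f x \<subseteq> W" if "shift_permutation W f" "x \<in> W" for f x
    using that by (auto simp: shift_permutation_def dest: permutes_orbit_subset)
  obtain x\<^sub>0 where "x\<^sub>0 \<in> W" using assms by auto
  then have start: "?P (f\<^sub>0, x\<^sub>0)" using perm by simp
  have bound: "\<forall>p. ?P p \<longrightarrow> ?m p < Suc (card W)"
    using sub assms(1) by (auto simp: less_Suc_eq_le intro!: card_mono)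
  obtain f x where fx: "shift_permutation W f" "x \<in> W"
    and max: "\<And>g y. shift_permutation W g \<Longrightarrow> y \<in> W \<Longrightarrow> card (orbit g y) \<le> card (orbit f x)"
    using ex_has_greatest_nat[OF start bound] by fastforce
  have f: "f permutes W" and shift: "\<And>w. w \<in> W \<Longrightarrow> butlast (f w) = tl w"
    using fx by (auto simp: shift_permutation_def)
  have "permutation f" using f assms(1) by (auto simp: permutation_permutes)
  have "shift_closed W (orbit f x)"
    unfolding shift_closed_def
  proof (intro ballI allI impI)
    fix u a assume u: "u \<in> orbit f x" and y: "tl u @ [a] \<in> W"
    have uW: "u \<in> W" using u sub[OF fx] by auto
    have orb: "orbit f u = orbit f x"
      using u cyclic_on_orbit'[OF \<open>permutation f\<close>, of x] by (rule orbit_cyclic_eq3[rotated])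
    \<comment> \<open>The word that \<open>f\<close> itself sends to the given successor of \<open>u\<close>; if it lay on another cycle,
      exchanging its image with that of \<open>u\<close> would give a larger orbit.\<close>
    obtain v where v: "v \<in> W" "f v = tl u @ [a]"
      using y permutes_image[OF f] by (metis imageE)
    have "tl u = tl v" using shift[OF v(1)] v(2) by simp
    have "v \<in> orbit f x"
    proof (rule ccontr)
      assume v_notin: "v \<notin> orbit f x"
      define g where "g = f \<circ> transpose u v"
      have g: "shift_permutation W g"
        unfolding g_def using fx(1) uW v(1) \<open>tl u = tl v\<close> by (rule shift_permutation_swap)
      have "orbit f u \<union> orbit f v \<subseteq> orbit g u"
        unfolding g_def using v_notin orb by (intro merge_orbits \<open>permutation f\<close>) auto
      moreover have "v \<in> orbit f v" by (rule permutation_self_in_orbit) fact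
      ultimately have "orbit f x \<subset> orbit g u" using v_notin orb by blast
      then have "card (orbit f x) < card (orbit g u)"
        using sub[OF g uW] assms(1) by (intro psubset_card_mono) (auto intro: finite_subset)
      then show False using max[OF g uW] by simp
    qed
    then show "tl u @ [a] \<in> orbit f x" using v(2) orbit.step by metis
  qed
  then have "orbit f x = W" using connected sub[OF fx] orbit_nonempty by metis
  then show thesis using that fx by blast
qed

text \<open>
  One shift moves every letter one place to the left, so letter \<open>j\<close> of a word is at the front
  after \<open>j\<close> steps. Hence the first letters along an orbit form a sequence whose windows are the words
  of the orbit.
\<close>

lemma nth_shift_orbit:
  assumes "shift_permutation W f" "x \<in> W" "\<And>w. w \<in> W \<Longrightarrow> length w = n" "j < n"
  shows "(f ^^ i) x ! j = hd ((f ^^ (i + j)) x)"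
  using assms(4)
proof (induction j arbitrary: i)
  have in_W: "(f ^^ i) x \<in> W" for i
    using assms(1,2) by (induction i) (auto simp: shift_permutation_def permutes_in_image)
  {
    case 0
    then show ?case using assms(3)[OF in_W[of i]] by (simp add: hd_conv_nth flip: length_greater_0_conv)
  next
    case (Suc j)
    have "butlast ((f ^^ Suc i) x) = tl ((f ^^ i) x)"
      using assms(1) in_W[of i] by (auto simp: shift_permutation_def)
    then have "(f ^^ i) x ! Suc j = (f ^^ Suc i) x ! j"
      using Suc.prems assms(3)[OF in_W[of i]] assms(3)[OF in_W[of "Suc i"]]
      by (metis Suc_less_eq2 diff_Suc_1 length_butlast nth_butlast nth_tl Suc_lessE)
    then show ?case using Suc.IH[of "Suc i"] Suc.prems by simp
  }
qed

theorem universal_cycle_exists: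
  assumes "finite \<Sigma>" and words: "W \<subseteq> {w. set w \<subseteq> \<Sigma> \<and> length w = n}" and "n > 0" "W \<noteq> {}"
    and "shift_permutation W f\<^sub>0"
    and "\<And>S. S \<subseteq> W \<Longrightarrow> S \<noteq> {} \<Longrightarrow> shift_closed W S \<Longrightarrow> S = W"
  shows "\<exists>c. universal_cycle \<Sigma> n W c"
proof -
  have "finite W"
    using words finite_lists_length_eq[OF assms(1)] by (rule finite_subset)
  have "[] \<notin> W" using words \<open>n > 0\<close> by auto
  obtain f x where f: "shift_permutation W f" and x: "x \<in> W" and orb: "orbit f x = W"
    using exists_cyclic_shift_permutation[OF \<open>finite W\<close> \<open>W \<noteq> {}\<close> assms(5,6)] by blast
  have len: "length w = n" if "w \<in> W" for w using words that by auto
  define L where "L = funpow_dist1 f x x"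
  have x_in: "x \<in> orbit f x" using orb x by simp
  have "L > 0" by (simp add: L_def)
  have period: "(f ^^ L) x = x" unfolding L_def by (rule funpow_dist1_prop[OF x_in])
  have inj: "inj_on (\<lambda>i. (f ^^ i) x) {0..<L}"
    unfolding L_def by (rule inj_on_funpow_dist1[OF x_in])
  have W_eq: "W = (\<lambda>i. (f ^^ i) x) ` {0..<L}"
    using orbit_conv_funpow_dist1[OF x_in] orb unfolding L_def by simp
  then have W: "w \<in> W \<longleftrightarrow> (\<exists>i<L. (f ^^ i) x = w)" for w
    by fastforce
  have card: "card W = L" using card_image[OF inj] W_eq by simp
  define c where "c = map (\<lambda>i. hd ((f ^^ i) x)) [0..<L]"
  \<comment> \<open>Makes the wrap-around of the windows agree with the periodicity of the orbit.\<close>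
  have mod: "(f ^^ (k mod L)) x = (f ^^ k) x" for k
    using period by (rule funpow_mod_eq)
  have window: "window c n i = (f ^^ i) x" if "i < L" for i
  proof (rule nth_equalityI)
    have "(f ^^ i) x \<in> W" using that W by auto
    then show "length (window c n i) = length ((f ^^ i) x)" by (simp add: window_def len)
    fix j assume "j < length (window c n i)"
    then have "j < n" by (simp add: window_def)
    then show "window c n i ! j = (f ^^ i) x ! j"
      using nth_shift_orbit[OF f x len] \<open>L > 0\<close> by (simp add: window_def c_def mod)
  qed
  have "set c \<subseteq> \<Sigma>"
  proof -
    have "hd ((f ^^ i) x) \<in> \<Sigma>" if "i < L" for i
    proof -
      have "(f ^^ i) x \<in> W" using that W by auto
      then show ?thesis using words \<open>n > 0\<close>
        by (metis (no_types, lifting) \<open>[] \<notin> W\<close> hd_in_set mem_Collect_eq subsetD)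
    qed
    then show ?thesis by (auto simp: c_def)
  qed
  moreover have "\<exists>!i. i < length c \<and> window c n i = w" if w: "w \<in> W" for w
  proof -
    obtain i where "i < L" "(f ^^ i) x = w" using w W by blast
    then show ?thesis
      using window inj by (intro ex1I[of _ i]) (auto simp: c_def inj_on_def)
  qed
  ultimately have "universal_cycle \<Sigma> n W c"
    using assms(1) words \<open>finite W\<close> card by (simp add: universal_cycle_def c_def)
  then show ?thesis by blast
qed

text \<open>
  The starting point of the construction. The map is the identity outside \<open>W\<close>, as \<open>permutes\<close>
  demands.
\<close>

lemma shift_permutation_rotate:
  assumes "finite W" "[] \<notin> W" "rotate1 ` W \<subseteq> W"
  shows "shift_permutation W (\<lambda>w. if w \<in> W then rotate1 w else w)"
proof -
  have "inj_on rotate1 W" using inj_rotate1 by (rule inj_on_subset) simp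
  then have "bij_betw rotate1 W W"
    using assms by (simp add: bij_betw_def endo_inj_surj)
  then have "bij_betw (\<lambda>w. if w \<in> W then rotate1 w else w) W W"
    by (rule bij_betw_cong[THEN iffD1, rotated]) simp
  then have "(\<lambda>w. if w \<in> W then rotate1 w else w) permutes W"
    by (rule bij_imp_permutes) simp
  moreover have "butlast (rotate1 w) = tl w" if "w \<in> W" for w
    using that assms(2) by (cases w) auto
  ultimately show ?thesis by (auto simp: shift_permutation_def)
qed

section \<open>Words containing a given letter\<close>

text \<open>
  Appending the letters of \<open>s\<close> one at a time leads from \<open>u\<close> along a walk, provided that every
  intermediate window is a word of \<open>W\<close>.
\<close>

lemma shift_closed_append:
  assumes "shift_closed W S" "u \<in> S"
    and "\<And>k. k \<le> length s \<Longrightarrow> drop k u @ take k s \<in> W"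
    and "length s \<le> length u"
  shows "drop (length s) u @ s \<in> S"
proof -
  have "drop k u @ take k s \<in> S" if "k \<le> length s" for k
    using that
  proof (induction k)
    case 0
    then show ?case using assms(2) by simp
  next
    case (Suc k)
    have eq: "tl (drop k u @ take k s) @ [s ! k] = drop (Suc k) u @ take (Suc k) s"
      using Suc.prems assms(4) by (simp add: take_Suc_conv_app_nth drop_Suc tl_drop tl_append2)
    show ?case
      using assms(1) Suc assms(3)[OF Suc.prems] unfolding shift_closed_def
      by (metis Suc_leD eq)
  qed
  from this[of "length s"] show ?thesis by simp
qed

lemma shift_closed_rotate:
  assumes "shift_closed W S" "u \<in> S" "[] \<notin> W" "S \<subseteq> W" "rotate1 ` W \<subseteq> W"
  shows "rotate k u \<in> S"
proof (induction k)
  case (Suc k)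
  have "rotate1 (rotate k u) = tl (rotate k u) @ [hd (rotate k u)]"
    using Suc assms(3,4) by (intro rotate1_hd_tl) auto
  moreover have "rotate1 (rotate k u) \<in> W" using Suc assms(4,5) by auto
  ultimately show ?case using Suc assms(1) by (auto simp: shift_closed_def)
qed (use assms(2) in simp)

text \<open>
  Every word is joined to every other one through the constant word \<open>a\<^sup>n\<close>. All windows on the way
  must contain \<open>a\<close>. On the way to \<open>a\<^sup>n\<close> this is so because \<open>a\<close> itself is appended. On the way to
  \<open>p a q\<close>, only the \<open>n - 1\<close> letters of \<open>q p\<close> are appended, so an \<open>a\<close> of the constant
  word survives at the front; rotating \<open>a q p\<close> then preserves the set of letters.
\<close>

lemma shift_connected_words_containing:
  fixes \<Sigma> :: "'a set" and n :: nat and a :: 'a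
  defines "W \<equiv> {w. set w \<subseteq> \<Sigma> \<and> length w = n \<and> a \<in> set w}"
  assumes "S \<subseteq> W" "S \<noteq> {}" and closed: "shift_closed W S"
  shows "S = W"
proof
  obtain u where u: "u \<in> S" using assms by auto
  then have "u \<in> W" using assms by auto
  then have "length u = n" "set u \<subseteq> \<Sigma>" "a \<in> set u" "a \<in> \<Sigma>" unfolding W_def by auto
  have drop: "set (drop k u) \<subseteq> \<Sigma>" for k
    using \<open>set u \<subseteq> \<Sigma>\<close> set_drop_subset by fast
  have "drop (length (replicate n a)) u @ replicate n a \<in> S"
  proof (rule shift_closed_append[OF closed u])
    fix k assume "k \<le> length (replicate n a)"
    then show "drop k u @ take k (replicate n a) \<in> W"
      using \<open>u \<in> W\<close> drop \<open>length u = n\<close> \<open>a \<in> \<Sigma>\<close>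
      by (cases "k = 0") (auto simp: W_def)
  qed (simp add: \<open>length u = n\<close>)
  then have const: "replicate n a \<in> S" using \<open>length u = n\<close> by simp
  show "W \<subseteq> S"
  proof
    fix w assume w: "w \<in> W"
    then obtain p q where pq: "w = p @ a # q" unfolding W_def using split_list by fast
    have sub: "set p \<subseteq> \<Sigma>" "set q \<subseteq> \<Sigma>" and n: "n = Suc (length p + length q)"
      using w pq unfolding W_def by auto
    have "drop (length (q @ p)) (replicate n a) @ (q @ p) \<in> S"
    proof (rule shift_closed_append[OF closed const])
      fix k assume "k \<le> length (q @ p)"
      moreover have "set (take k (q @ p)) \<subseteq> \<Sigma>" using sub set_take_subset[of k "q @ p"] by auto
      moreover have "drop k (replicate n a) = a # replicate (n - k - 1) a" if "k < n"
        using that by (simp add: drop_replicate flip: replicate_Suc)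
      ultimately show "drop k (replicate n a) @ take k (q @ p) \<in> W"
        using \<open>a \<in> \<Sigma>\<close> n by (auto simp: W_def simp del: take_append replicate_Suc)
    qed (simp add: n)
    moreover have "drop (length (q @ p)) (replicate n a) = [a]"
      by (subst drop_replicate) (simp add: n)
    ultimately have "a # q @ p \<in> S" by simp
    then have "rotate (length (a # q)) (a # q @ p) \<in> S"
      by (rule shift_closed_rotate[OF closed]) (use assms n in \<open>auto simp: W_def\<close>)
    then show "w \<in> S" using rotate_append[of "a # q" p] pq by simp
  qed
qed fact

text \<open>
  The ambient alphabet \<open>\<Sigma>'\<close> may be larger than the set \<open>\<Sigma>\<close> of letters that occur: the letter \<open>2\<close>
  belongs to the alphabet of the encodings but appears in no encoding of a chain.
\<close>

theorem universal_cycle_words_containing: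
  assumes "finite \<Sigma>'" "\<Sigma> \<subseteq> \<Sigma>'" "a \<in> \<Sigma>" "n > 0"
  shows "\<exists>c. universal_cycle \<Sigma>' n {w. set w \<subseteq> \<Sigma> \<and> length w = n \<and> a \<in> set w} c"
    (is "\<exists>c. universal_cycle _ _ ?W c")
proof (rule universal_cycle_exists)
  have "finite \<Sigma>" using assms(1,2) by (rule rev_finite_subset)
  then have "finite ?W"
    by (intro finite_subset[OF _ finite_lists_length_eq[of \<Sigma> n]]) auto
  then show "shift_permutation ?W (\<lambda>w. if w \<in> ?W then rotate1 w else w)"
    using \<open>n > 0\<close> by (intro shift_permutation_rotate) auto
  have "replicate n a \<in> ?W" using assms by auto
  then show "?W \<noteq> {}" by blast
  show "?W \<subseteq> {w. set w \<subseteq> \<Sigma>' \<and> length w = n}" using assms(2) by auto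
qed (fact assms shift_connected_words_containing)+

section \<open>The words encoding two-chains\<close>

lemma nth_encoding:
  "i < n \<Longrightarrow> encoding n (A, B) ! i
     = 2 * (if Suc i \<in> A then 1 else 0) + (if Suc i \<in> B then 1 else 0)"
  by (simp add: encoding_def combine_def indicator_string_def del: upt_Suc)

lemma length_encoding [simp]: "length (encoding n (A, B)) = n"
  by (simp add: encoding_def combine_def indicator_string_def del: upt_Suc)

text \<open>
  The letter \<open>2\<close> at a position would put that element in \<open>A\<^sub>1\<close> but not in \<open>A\<^sub>2\<close>; the letter \<open>1\<close>
  marks an element of \<open>A\<^sub>2\<close> outside \<open>A\<^sub>1\<close>, which witnesses properness.
\<close>

lemma encoding_two_chains:
  "encoding n ` proper_two_chains n = {w. set w \<subseteq> {0, 1, 3} \<and> length w = n \<and> 1 \<in> set w}"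
proof (intro equalityI subsetI)
  fix w assume "w \<in> encoding n ` proper_two_chains n"
  then obtain A B where AB: "A \<subset> B" "B \<subseteq> {1..n}" and w: "w = encoding n (A, B)"
    by (auto simp: proper_two_chains_def)
  obtain b where "b \<in> B" "b \<notin> A" using AB by auto
  then have "b - 1 < n" "w ! (b - 1) = 1" using AB w nth_encoding[of "b - 1" n A B] by force+
  then have "1 \<in> set w" using w by (metis length_encoding nth_mem)
  moreover have "i \<in> B" if "i \<in> A" for i
    using AB that by auto
  then have "set w \<subseteq> {0, 1, 3}"
    by (auto simp: w in_set_conv_nth nth_encoding split: if_splits)
  ultimately show "w \<in> {w. set w \<subseteq> {0, 1, 3} \<and> length w = n \<and> 1 \<in> set w}" using w by simp
next
  fix w :: "nat list" assume "w \<in> {w. set w \<subseteq> {0, 1, 3} \<and> length w = n \<and> 1 \<in> set w}"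
  then have w: "set w \<subseteq> {0, 1, 3}" "length w = n" "1 \<in> set w" by auto
  define A where "A = {i \<in> {1..n}. w ! (i - 1) = 3}"
  define B where "B = {i \<in> {1..n}. w ! (i - 1) \<noteq> 0}"
  have enc: "encoding n (A, B) = w"
  proof (rule nth_equalityI)
    fix i assume "i < length (encoding n (A, B))"
    then have "i < n" by simp
    then have "w ! i \<in> {0, 1, 3}" using w nth_mem by blast
    then show "encoding n (A, B) ! i = w ! i"
      using \<open>i < n\<close> by (auto simp: nth_encoding A_def B_def)
  qed (simp add: w)
  obtain i where "i < n" "w ! i = 1" using w by (auto simp: in_set_conv_nth)
  then have "Suc i \<in> B - A" by (simp add: A_def B_def)
  moreover have "A \<subseteq> B" "B \<subseteq> {1..n}" by (auto simp: A_def B_def)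
  ultimately have "(A, B) \<in> proper_two_chains n" by (auto simp: proper_two_chains_def)
  then show "w \<in> encoding n ` proper_two_chains n" using enc by force
qed

theorem corollary14:
  fixes n :: nat
  assumes "n \<ge> 1"
  shows "\<exists>c. universal_cycle {0, 1, 2, 3} n (encoding n ` proper_two_chains n) c"
  unfolding encoding_two_chains using assms
  by (intro universal_cycle_words_containing) auto

end
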